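(* For each fixed integer $n\ge 2$, $$\frac{\mathcal{C}^{(n)}_m-\mathbb{E}(\mathcal{C}^{(n)}_m)}{\sqrt{\mathbb{V}(\mathcal{C}^{(n)}_m)}}\ \xrightarrow{\ d\ }\ \mathcal{N}\qquad\text{as } m\to\infty .$$ More generally, for any sequence $(n_m)$ of integers with $n_m\ge 2$ for every $m$, $$\frac{\mathcal{C}^{(n_m)}_m-\mathbb{E}(\mathcal{C}^{(n_m)}_m)}{\sqrt{\mathbb{V}(\mathcal{C}^{(n_m)}_m)}}\ \xrightarrow{\ d\ }\ \mathcal{N}\qquad\text{as } m\to\infty .$$
   Context: For each integer $n\ge1$, $X^{(n)}_1,X^{(n)}_2,\ldots$ is a sequence of independent random variables uniformly distributed in $\{1,\ldots,n\}$, defined on a probability space with probability $\mathbf{P}$; $\mathbb{E}$ and $\mathbb{V}$ denote expectation and variance. For $m\ge2$, $$\mathcal{C}^{(n)}_m=\sum_{1\le i<j\le m}\mathbf{1}_{\gcd(X^{(n)}_i,X^{(n)}_j)=1}$$ is the number of coprime pairs in the sample $X^{(n)}_1,\ldots,X^{(n)}_m$. The symbol $\xrightarrow{d}$ means convergence in distribution and $\mathcal{N}$ is a standard normal variable. *)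

theory Defs
  imports "HOL-Probability.Probability"
begin

definition coprime_pairs :: "(nat \<Rightarrow> 'a \<Rightarrow> nat) \<Rightarrow> nat \<Rightarrow> 'a \<Rightarrow> real" where
  "coprime_pairs X m \<omega> =
     (\<Sum>(i, j) \<in> {(i, j). 1 \<le> i \<and> i < j \<and> j \<le> m}. of_bool (gcd (X i \<omega>) (X j \<omega>) = 1))"

definition standardized :: "'a measure \<Rightarrow> ('a \<Rightarrow> real) \<Rightarrow> 'a \<Rightarrow> real" where
  "standardized M Y \<omega> =
     (Y \<omega> - prob_space.expectation M Y) / sqrt (prob_space.variance M Y)"

end

theory Submission
  imports Defs "HOL-Real_Asymp.Real_Asymp"
begin

text \<open>
  The number of coprime pairs is a U-statistic of degree two: it sums the symmetric bounded kernel
  \<open>h x y = [gcd x y = 1]\<close> over the pairs \<open>i < j\<close> of an independent sample. Write \<open>\<theta>\<close> for the mean of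
  the kernel, \<open>a x\<close> for the centred mean of \<open>h x Y\<close>, and \<open>\<sigma>\<^sup>2\<close> for the variance of \<open>a X\<close>. Hoeffding's
  decomposition \<open>h x y = \<theta> + a x + a y + g x y\<close>, in which \<open>g\<close> has mean zero in each variable
  separately, gives \<open>U - E U = (m - 1) S + R\<close> with \<open>S = \<Sum> a (X i)\<close> and \<open>R = \<Sum> g (X i) (X j)\<close>.

  The terms of \<open>S\<close> and of \<open>R\<close> are pairwise orthogonal (\<open>expectation_fresh_eq_0\<close>). So \<open>(m - 1) S\<close> has
  variance \<open>(m - 1)\<^sup>2 m \<sigma>\<^sup>2\<close>, while that of \<open>R\<close> is only of order \<open>m\<^sup>2\<close>. Hence the standardised \<open>U\<close> is
  close in mean square to the standardised sum \<open>S\<close> of independent bounded variables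
  (\<open>expectation_U_S_difference_le\<close>), for which the central limit theorem holds with an explicit error
  (\<open>char_S_le\<close>). The resulting bound on characteristic functions (\<open>char_standardized_U_le\<close>) depends on
  the sample law only through a lower bound for \<open>\<sigma>\<^sup>2\<close>. This is why the range \<open>n\<close> may vary with \<open>m\<close> in
  an arbitrary way, as soon as \<open>\<sigma>\<^sup>2\<close> is bounded below uniformly in \<open>n \<ge> 2\<close>.

  That uniform bound is the arithmetic content (\<open>variance_coprime_fraction_ge\<close>). Here \<open>a x + \<theta>\<close> is the
  fraction of \<open>{1..n}\<close> that is coprime to \<open>x\<close>. For even \<open>x\<close> it is at most about one half, whereas its
  mean exceeds one half by a fixed amount, since the union bound over common divisors 2, 3, 5, 7, 9,
  \<dots> shows that distinctly fewer than half of all pairs fail to be coprime. The finitely many small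
  \<open>n\<close> are settled by comparing \<open>x = 1\<close> with \<open>x = n\<close>.
\<close>

section \<open>Sums over pairs of indices\<close>

definition index_pairs :: "nat \<Rightarrow> (nat \<times> nat) set" where
  "index_pairs m = {(i, j). 1 \<le> i \<and> i < j \<and> j \<le> m}"

lemma index_pairs_subset: "index_pairs m \<subseteq> {1..m} \<times> {1..m}"
  by (auto simp: index_pairs_def)

lemma finite_index_pairs [simp, intro]: "finite (index_pairs m)"
  by (rule finite_subset[OF index_pairs_subset]) simp

lemma card_index_pairs_le: "card (index_pairs m) \<le> m\<^sup>2"
  using card_mono[OF _ index_pairs_subset, of m]
  by (simp add: card_cartesian_product power2_eq_square)

text \<open>Each index lies in exactly \<open>m - 1\<close> pairs. This is the factor that the linear part of
  the statistic carries below.\<close>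

lemma sum_index_pairs_add:
  fixes a :: "nat \<Rightarrow> real"
  shows "(\<Sum>(i, j)\<in>index_pairs m. a i + a j) = (real m - 1) * (\<Sum>i=1..m. a i)"
proof (induction m)
  case 0
  have "index_pairs 0 = {}" by (auto simp: index_pairs_def)
  then show ?case by simp
next
  case (Suc m)
  have split: "index_pairs (Suc m) = index_pairs m \<union> {1..m} \<times> {Suc m}"
    by (auto simp: index_pairs_def)
  have "(\<Sum>(i, j)\<in>index_pairs (Suc m). a i + a j) =
      (\<Sum>(i, j)\<in>index_pairs m. a i + a j) + (\<Sum>(i, j)\<in>{1..m} \<times> {Suc m}. a i + a j)"
    unfolding split by (rule sum.union_disjoint) (simp, simp, auto simp: index_pairs_def)
  also have "(\<Sum>(i, j)\<in>{1..m} \<times> {Suc m}. a i + a j) = (\<Sum>i=1..m. a i) + real m * a (Suc m)"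
    by (simp add: sum.cartesian_product[symmetric] sum.distrib)
  finally show ?case
    by (simp add: Suc.IH algebra_simps)
qed

section \<open>Independent samples from a discrete law\<close>

text \<open>Countability of the value type makes every function of finitely many sample points measurable.\<close>

locale iid_sample = prob_space M for M :: "'a measure" +
  fixes X :: "nat \<Rightarrow> 'a \<Rightarrow> 'b :: countable" and p :: "'b pmf"
  assumes indep_X: "indep_vars (\<lambda>_. count_space UNIV) X {1..}"
    and distr_X: "\<And>i. 1 \<le> i \<Longrightarrow> distr M (count_space UNIV) (X i) = measure_pmf p"
begin

lemma measurable_X: "1 \<le> i \<Longrightarrow> X i \<in> measurable M (count_space UNIV)"
  using indep_X by (auto simp: indep_vars_def)

lemma expectation_X:
  fixes f :: "'b \<Rightarrow> real"
  assumes "1 \<le> i"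
  shows "expectation (\<lambda>\<omega>. f (X i \<omega>)) = measure_pmf.expectation p f"
  unfolding distr_X[OF assms, symmetric]
  by (rule integral_distr[symmetric]) (use measurable_X[OF assms] in auto)

lemma measurable_X2:
  assumes "1 \<le> i" "1 \<le> j"
  shows "(\<lambda>\<omega>. (X i \<omega>, X j \<omega>)) \<in> measurable M (count_space UNIV)"
proof -
  have "(\<lambda>\<omega>. (X i \<omega>, X j \<omega>)) \<in> measurable M (count_space UNIV \<Otimes>\<^sub>M count_space UNIV)"
    by (intro measurable_Pair measurable_X assms)
  then show ?thesis by (simp add: pair_measure_countable)
qed

lemma borel_measurable_X2:
  fixes f :: "'b \<Rightarrow> 'b \<Rightarrow> real"
  assumes "1 \<le> i" "1 \<le> j"
  shows "(\<lambda>\<omega>. f (X i \<omega>) (X j \<omega>)) \<in> borel_measurable M"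
  using measurable_compose[OF measurable_X2[OF assms], of "\<lambda>(x, y). f x y" borel] by simp

text \<open>The one consequence of independence from which all orthogonality relations follow: conditionally
  on the sample points other than \<open>X i\<close>, the factor \<open>f (X i) (X j)\<close> already averages to zero. An
  \<open>f\<close> that depends on its first argument alone gives the relations for linear statistics.\<close>

lemma expectation_fresh_eq_0:
  fixes f :: "'b \<Rightarrow> 'b \<Rightarrow> real" and \<phi> :: "'b \<Rightarrow> 'b \<Rightarrow> real"
  assumes idx: "1 \<le> i" "1 \<le> j" "1 \<le> k" "1 \<le> l" and fresh: "i \<notin> {j, k, l}"
    and f: "\<And>x y. \<bar>f x y\<bar> \<le> A" and \<phi>: "\<And>x y. \<bar>\<phi> x y\<bar> \<le> B"
    and centred: "\<And>y. measure_pmf.expectation p (\<lambda>x. f x y) = 0"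
  shows "expectation (\<lambda>\<omega>. f (X i \<omega>) (X j \<omega>) * \<phi> (X k \<omega>) (X l \<omega>)) = 0"
proof -
  let ?P = "\<lambda>I. PiM I (\<lambda>_. count_space (UNIV :: 'b set))"
  let ?U = "\<lambda>\<omega>. restrict (\<lambda>i. X i \<omega>) {i}"
  let ?V = "\<lambda>\<omega>. restrict (\<lambda>i. X i \<omega>) {j, k, l}"
  let ?F = "\<lambda>z w. f (z i) (w j) * \<phi> (w k) (w l)"
  \<comment> \<open>Independence is used at the level of the product spaces: the joint law of \<open>X i\<close> and of the
    other points is a product measure, so Fubini lets \<open>X i\<close> be integrated out first.\<close>
  have ind: "indep_var (?P {i}) ?U (?P {j, k, l}) ?V"
    using idx fresh by (intro indep_var_restrict[OF indep_X]) auto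
  then have rv: "?U \<in> measurable M (?P {i})" "?V \<in> measurable M (?P {j, k, l})"
    by (auto dest: indep_var_rv1 indep_var_rv2)
  have joint: "distr M (?P {i}) ?U \<Otimes>\<^sub>M distr M (?P {j, k, l}) ?V =
      distr M (?P {i} \<Otimes>\<^sub>M ?P {j, k, l}) (\<lambda>\<omega>. (?U \<omega>, ?V \<omega>))"
    using ind by (simp add: indep_var_distribution_eq)
  interpret U: prob_space "distr M (?P {i}) ?U" by (rule prob_space_distr[OF rv(1)])
  interpret V: prob_space "distr M (?P {j, k, l}) ?V" by (rule prob_space_distr[OF rv(2)])
  interpret UV: pair_prob_space "distr M (?P {i}) ?U" "distr M (?P {j, k, l}) ?V" ..
  have "(\<lambda>(z, w). (z i, w j, w k, w l)) \<in> measurable (?P {i} \<Otimes>\<^sub>M ?P {j, k, l})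
      (count_space UNIV \<Otimes>\<^sub>M count_space UNIV \<Otimes>\<^sub>M count_space UNIV \<Otimes>\<^sub>M count_space UNIV)"
    unfolding split_beta'
    by (intro measurable_Pair measurable_compose[OF measurable_fst]
        measurable_compose[OF measurable_snd] measurable_component_singleton) auto
  then have "(\<lambda>(z, w). (z i, w j, w k, w l)) \<in> measurable (?P {i} \<Otimes>\<^sub>M ?P {j, k, l}) (count_space UNIV)"
    by (simp add: pair_measure_countable)
  from measurable_compose[OF this, of "\<lambda>(x, y, u, v). f x y * \<phi> u v" borel]
  have meas: "(\<lambda>(z, w). ?F z w) \<in> borel_measurable (?P {i} \<Otimes>\<^sub>M ?P {j, k, l})"
    by (simp add: split_beta')
  have "expectation (\<lambda>\<omega>. f (X i \<omega>) (X j \<omega>) * \<phi> (X k \<omega>) (X l \<omega>)) =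
      (LINT zw|distr M (?P {i} \<Otimes>\<^sub>M ?P {j, k, l}) (\<lambda>\<omega>. (?U \<omega>, ?V \<omega>)). (\<lambda>(z, w). ?F z w) zw)"
    by (subst integral_distr[OF measurable_Pair[OF rv] meas]) auto
  also have "\<dots> = (LINT w|distr M (?P {j, k, l}) ?V. LINT z|distr M (?P {i}) ?U. ?F z w)"
    unfolding joint[symmetric]
  proof (rule UV.integral_snd[symmetric])
    have "\<bar>f x y * \<phi> u v\<bar> \<le> A * B" for x y u v
      unfolding abs_mult using f[of x y] \<phi>[of u v] by (intro mult_mono) auto
    then show "integrable (distr M (?P {i}) ?U \<Otimes>\<^sub>M distr M (?P {j, k, l}) ?V) (\<lambda>(z, w). ?F z w)"
      using meas by (intro UV.P.integrable_const_bound[where B = "A * B"]) auto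
  qed
  also have "(\<lambda>w. LINT z|distr M (?P {i}) ?U. ?F z w) = (\<lambda>w. 0)"
  proof
    fix w :: "nat \<Rightarrow> 'b"
    have "(LINT z|distr M (?P {i}) ?U. f (z i) (w j)) = expectation (\<lambda>\<omega>. f (X i \<omega>) (w j))"
      by (subst integral_distr[OF rv(1)])
         (auto intro!: measurable_compose[OF measurable_component_singleton])
    then show "(LINT z|distr M (?P {i}) ?U. ?F z w) = 0"
      by (simp add: expectation_X[OF idx(1), of "\<lambda>x. f x (w j)"] centred)
  qed
  finally show ?thesis by simp
qed

end

section \<open>Hoeffding decomposition of a U-statistic of degree two\<close>

text \<open>The mean of the kernel when one argument is held at \<open>x\<close>. Its variance decides whether the
  U-statistic is asymptotically normal.\<close>

definition first_projection :: "'b pmf \<Rightarrow> ('b \<Rightarrow> 'b \<Rightarrow> real) \<Rightarrow> 'b \<Rightarrow> real" where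
  "first_projection p h x = measure_pmf.expectation p (h x)"

lemma pmf_expectation_unit_interval:
  fixes f :: "'b \<Rightarrow> real"
  assumes "\<And>x. 0 \<le> f x" "\<And>x. f x \<le> 1"
  shows "0 \<le> measure_pmf.expectation p f" "measure_pmf.expectation p f \<le> 1"
proof -
  show "0 \<le> measure_pmf.expectation p f" by (simp add: assms)
  have "measure_pmf.expectation p f \<le> measure_pmf.expectation p (\<lambda>_. 1)"
    by (intro integral_mono measure_pmf.integrable_const_bound[where B = 1]) (auto simp: assms)
  then show "measure_pmf.expectation p f \<le> 1" by simp
qed

locale kernel_sample = iid_sample M X p
  for M :: "'a measure" and X :: "nat \<Rightarrow> 'a \<Rightarrow> 'b :: countable" and p :: "'b pmf" +
  fixes h :: "'b \<Rightarrow> 'b \<Rightarrow> real"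
  assumes h_sym: "h x y = h y x" and h_nonneg: "0 \<le> h x y" and h_le_1: "h x y \<le> 1"
begin

definition kernel_mean :: real where
  "kernel_mean = measure_pmf.expectation p (first_projection p h)"

text \<open>Subtracting the mean and the linear part in each variable leaves a kernel that has mean zero in each variable
  separately (a completely degenerate kernel). This makes the linear statistic \<open>S\<close> and the
  remainder \<open>R\<close> below orthogonal, and distinct terms of \<open>R\<close> orthogonal to one another.\<close>

definition linear_part :: "'b \<Rightarrow> real" where
  "linear_part x = first_projection p h x - kernel_mean"

definition degenerate_part :: "'b \<Rightarrow> 'b \<Rightarrow> real" where
  "degenerate_part x y = h x y - kernel_mean - linear_part x - linear_part y"

definition \<sigma>2 :: real where
  "\<sigma>2 = measure_pmf.variance p (first_projection p h)"

definition U :: "nat \<Rightarrow> 'a \<Rightarrow> real" where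
  "U m \<omega> = (\<Sum>(i, j)\<in>index_pairs m. h (X i \<omega>) (X j \<omega>))"

definition S :: "nat \<Rightarrow> 'a \<Rightarrow> real" where
  "S m \<omega> = (\<Sum>i=1..m. linear_part (X i \<omega>))"

definition R :: "nat \<Rightarrow> 'a \<Rightarrow> real" where
  "R m \<omega> = (\<Sum>(i, j)\<in>index_pairs m. degenerate_part (X i \<omega>) (X j \<omega>))"

lemma U_decomposition:
  "U m \<omega> = real (card (index_pairs m)) * kernel_mean + ((real m - 1) * S m \<omega> + R m \<omega>)"
proof -
  have "U m \<omega> = (\<Sum>(i, j)\<in>index_pairs m. kernel_mean +
      (linear_part (X i \<omega>) + linear_part (X j \<omega>)) + degenerate_part (X i \<omega>) (X j \<omega>))"
    unfolding U_def degenerate_part_def by (intro sum.cong) auto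
  also have "\<dots> = real (card (index_pairs m)) * kernel_mean +
      (\<Sum>(i, j)\<in>index_pairs m. linear_part (X i \<omega>) + linear_part (X j \<omega>)) + R m \<omega>"
    by (simp add: R_def split_beta' sum.distrib)
  finally show ?thesis by (simp add: sum_index_pairs_add S_def)
qed

lemma first_projection_bounds: "0 \<le> first_projection p h x" "first_projection p h x \<le> 1"
  unfolding first_projection_def by (intro pmf_expectation_unit_interval h_nonneg h_le_1)+

lemma kernel_mean_bounds: "0 \<le> kernel_mean" "kernel_mean \<le> 1"
  unfolding kernel_mean_def by (intro pmf_expectation_unit_interval first_projection_bounds)+

lemma abs_linear_part_le: "\<bar>linear_part x\<bar> \<le> 1"
  using first_projection_bounds[of x] kernel_mean_bounds by (auto simp: linear_part_def abs_le_iff)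

lemma abs_degenerate_part_le: "\<bar>degenerate_part x y\<bar> \<le> 4"
  using h_nonneg[of x y] h_le_1[of x y] kernel_mean_bounds
    abs_linear_part_le[of x] abs_linear_part_le[of y]
  unfolding degenerate_part_def by linarith

lemma integrable_projection: "integrable (measure_pmf p) (first_projection p h)"
  by (intro measure_pmf.integrable_const_bound[where B = 1]) (auto simp: first_projection_bounds)

lemma integrable_kernel: "integrable (measure_pmf p) (\<lambda>x. h x y)"
  by (intro measure_pmf.integrable_const_bound[where B = 1]) (auto simp: h_nonneg h_le_1)

lemma integrable_linear_part: "integrable (measure_pmf p) linear_part"
  by (intro measure_pmf.integrable_const_bound[where B = 1]) (auto simp: abs_linear_part_le)

lemma expectation_linear_part: "measure_pmf.expectation p linear_part = 0"
  unfolding linear_part_def using integrable_projection by (simp add: kernel_mean_def)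

lemma \<sigma>2_eq: "\<sigma>2 = measure_pmf.expectation p (\<lambda>x. (linear_part x)\<^sup>2)"
  by (simp add: \<sigma>2_def linear_part_def kernel_mean_def)

lemma degenerate_part_sym: "degenerate_part x y = degenerate_part y x"
  by (simp add: degenerate_part_def h_sym[of x y])

lemma expectation_degenerate_part: "measure_pmf.expectation p (\<lambda>x. degenerate_part x y) = 0"
proof -
  have "measure_pmf.expectation p (\<lambda>x. h x y) = kernel_mean + linear_part y"
    by (simp add: h_sym[of _ y] linear_part_def first_projection_def)
  then show ?thesis
    unfolding degenerate_part_def
    using integrable_kernel[of y] integrable_linear_part by (simp add: expectation_linear_part)
qed

lemma integrable_product:
  fixes f \<phi> :: "'b \<Rightarrow> 'b \<Rightarrow> real"
  assumes "1 \<le> i" "1 \<le> j" "1 \<le> k" "1 \<le> l"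
    and "\<And>x y. \<bar>f x y\<bar> \<le> A" and "\<And>x y. \<bar>\<phi> x y\<bar> \<le> B"
  shows "integrable M (\<lambda>\<omega>. f (X i \<omega>) (X j \<omega>) * \<phi> (X k \<omega>) (X l \<omega>))"
proof (rule integrable_const_bound[where B = "A * B"])
  show "AE \<omega> in M. norm (f (X i \<omega>) (X j \<omega>) * \<phi> (X k \<omega>) (X l \<omega>)) \<le> A * B"
    unfolding real_norm_def abs_mult using assms(5,6)
    by (intro AE_I2 mult_mono) (auto intro: order_trans[OF abs_ge_zero])
  show "(\<lambda>\<omega>. f (X i \<omega>) (X j \<omega>) * \<phi> (X k \<omega>) (X l \<omega>)) \<in> borel_measurable M"
    by (intro borel_measurable_times borel_measurable_X2 assms)
qed

lemma linear_part_orthogonal: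
  assumes "1 \<le> i" "1 \<le> k"
  shows "integrable M (\<lambda>\<omega>. linear_part (X i \<omega>) * linear_part (X k \<omega>))"
    and "expectation (\<lambda>\<omega>. linear_part (X i \<omega>) * linear_part (X k \<omega>)) = (if i = k then \<sigma>2 else 0)"
proof -
  show "integrable M (\<lambda>\<omega>. linear_part (X i \<omega>) * linear_part (X k \<omega>))"
    by (rule integrable_product[where f = "\<lambda>x _. linear_part x" and \<phi> = "\<lambda>x _. linear_part x"
          and j = k and l = k and A = 1 and B = 1])
       (use assms abs_linear_part_le in auto)
  show "expectation (\<lambda>\<omega>. linear_part (X i \<omega>) * linear_part (X k \<omega>)) = (if i = k then \<sigma>2 else 0)"
  proof (cases "i = k")
    case True
    then show ?thesis
      using expectation_X[OF assms(1), of "\<lambda>x. (linear_part x)\<^sup>2"] by (simp add: \<sigma>2_eq power2_eq_square)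
  next
    case False
    have "expectation (\<lambda>\<omega>. linear_part (X i \<omega>) * linear_part (X k \<omega>)) = 0"
      by (rule expectation_fresh_eq_0[where f = "\<lambda>x _. linear_part x" and \<phi> = "\<lambda>x _. linear_part x"
            and j = k and l = k and A = 1 and B = 1])
         (use False assms abs_linear_part_le expectation_linear_part in auto)
    with False show ?thesis by simp
  qed
qed

text \<open>Some index of the pair \<open>{i, j}\<close> is missing from \<open>{k, l}\<close>; by symmetry of the kernel it can be
  moved to the first place, and then it is averaged out.\<close>

lemma degenerate_fresh_eq_0:
  fixes \<phi> :: "'b \<Rightarrow> 'b \<Rightarrow> real"
  assumes "1 \<le> i" "1 \<le> j" "1 \<le> k" "1 \<le> l" "i \<noteq> j" "\<not> {i, j} \<subseteq> {k, l}"
    and \<phi>: "\<And>x y. \<bar>\<phi> x y\<bar> \<le> B"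
  shows "expectation (\<lambda>\<omega>. degenerate_part (X i \<omega>) (X j \<omega>) * \<phi> (X k \<omega>) (X l \<omega>)) = 0"
proof (cases "i \<in> {k, l}")
  case False
  with assms show ?thesis
    by (intro expectation_fresh_eq_0[where A = 4] abs_degenerate_part_le expectation_degenerate_part) auto
next
  case True
  with assms have "expectation (\<lambda>\<omega>. degenerate_part (X j \<omega>) (X i \<omega>) * \<phi> (X k \<omega>) (X l \<omega>)) = 0"
    by (intro expectation_fresh_eq_0[where A = 4] abs_degenerate_part_le expectation_degenerate_part) auto
  then show ?thesis by (simp add: degenerate_part_sym)
qed

lemma square_integrable_S: "integrable M (\<lambda>\<omega>. (S m \<omega>)\<^sup>2)"
  and expectation_S_square: "expectation (\<lambda>\<omega>. (S m \<omega>)\<^sup>2) = real m * \<sigma>2"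
proof -
  have eq: "(S m \<omega>)\<^sup>2 = (\<Sum>i=1..m. \<Sum>k=1..m. linear_part (X i \<omega>) * linear_part (X k \<omega>))" for \<omega>
    by (simp add: S_def power2_eq_square sum_product)
  show "integrable M (\<lambda>\<omega>. (S m \<omega>)\<^sup>2)"
    unfolding eq by (intro Bochner_Integration.integrable_sum linear_part_orthogonal) auto
  have "expectation (\<lambda>\<omega>. (S m \<omega>)\<^sup>2) =
      (\<Sum>i=1..m. \<Sum>k=1..m. expectation (\<lambda>\<omega>. linear_part (X i \<omega>) * linear_part (X k \<omega>)))"
    unfolding eq
    by (subst Bochner_Integration.integral_sum;
        (intro sum.cong refl Bochner_Integration.integral_sum Bochner_Integration.integrable_sum linear_part_orthogonal)?) auto
  also have "\<dots> = (\<Sum>i=1..m. \<Sum>k=1..m. if i = k then \<sigma>2 else 0)"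
    by (intro sum.cong refl linear_part_orthogonal) auto
  finally show "expectation (\<lambda>\<omega>. (S m \<omega>)\<^sup>2) = real m * \<sigma>2" by simp
qed

lemma integrable_S: "integrable M (S m)"
  and expectation_S: "expectation (S m) = 0"
proof -
  have int: "integrable M (\<lambda>\<omega>. linear_part (X i \<omega>))" if "1 \<le> i" for i
    using integrable_product[of i i i i "\<lambda>x _. linear_part x" 1 "\<lambda>_ _. 1" 1] that abs_linear_part_le
    by simp
  show "integrable M (S m)"
    unfolding S_def by (intro Bochner_Integration.integrable_sum int) auto
  show "expectation (S m) = 0"
    unfolding S_def
    by (subst Bochner_Integration.integral_sum)
       (auto intro!: int sum.neutral simp: expectation_X expectation_linear_part)
qed

lemma integrable_R: "integrable M (R m)"
  and expectation_R: "expectation (R m) = 0"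
proof -
  have int: "integrable M (\<lambda>\<omega>. degenerate_part (X i \<omega>) (X j \<omega>))" if "(i, j) \<in> index_pairs m" for i j
    using integrable_product[of i j i j degenerate_part 4 "\<lambda>_ _. 1" 1] that abs_degenerate_part_le
    by (simp add: index_pairs_def)
  have zero: "expectation (\<lambda>\<omega>. degenerate_part (X i \<omega>) (X j \<omega>)) = 0" if "(i, j) \<in> index_pairs m" for i j
    using degenerate_fresh_eq_0[of i j i i "\<lambda>_ _. 1" 1] that by (simp add: index_pairs_def)
  show "integrable M (R m)"
    unfolding R_def split_beta' by (intro Bochner_Integration.integrable_sum int) auto
  show "expectation (R m) = 0"
    unfolding R_def split_beta'
    by (subst Bochner_Integration.integral_sum) (auto intro!: int sum.neutral zero)
qed

lemma integrable_S_R: "integrable M (\<lambda>\<omega>. S m \<omega> * R m \<omega>)"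
  and expectation_S_R: "expectation (\<lambda>\<omega>. S m \<omega> * R m \<omega>) = 0"
proof -
  let ?T = "\<lambda>k q \<omega>. degenerate_part (X (fst q) \<omega>) (X (snd q) \<omega>) * linear_part (X k \<omega>)"
  have eq: "S m \<omega> * R m \<omega> = (\<Sum>k=1..m. \<Sum>q\<in>index_pairs m. ?T k q \<omega>)" for \<omega>
    by (simp add: S_def R_def sum_product split_beta' mult.commute)
  have int: "integrable M (?T k q)" if "k \<in> {1..m}" "q \<in> index_pairs m" for k q
    by (rule integrable_product[where \<phi> = "\<lambda>x _. linear_part x" and l = k and A = 4 and B = 1])
       (use that abs_degenerate_part_le abs_linear_part_le in \<open>auto simp: index_pairs_def\<close>)
  have zero: "expectation (?T k q) = 0" if "k \<in> {1..m}" "q \<in> index_pairs m" for k q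
    by (rule degenerate_fresh_eq_0[where \<phi> = "\<lambda>x _. linear_part x" and l = k and B = 1])
       (use that abs_linear_part_le in \<open>auto simp: index_pairs_def\<close>)
  show "integrable M (\<lambda>\<omega>. S m \<omega> * R m \<omega>)"
    unfolding eq by (intro Bochner_Integration.integrable_sum int)
  have "expectation (\<lambda>\<omega>. S m \<omega> * R m \<omega>) = (\<Sum>k=1..m. \<Sum>q\<in>index_pairs m. expectation (?T k q))"
    unfolding eq
    by (subst Bochner_Integration.integral_sum;
        (intro sum.cong refl Bochner_Integration.integral_sum Bochner_Integration.integrable_sum int)?) auto
  then show "expectation (\<lambda>\<omega>. S m \<omega> * R m \<omega>) = 0"
    by (simp add: zero)
qed

text \<open>Of the \<open>m\<^sup>4\<close> or so products in \<open>R\<^sup>2\<close> only the diagonal ones can have non-zero mean. So \<open>R\<close> has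
  variance of order \<open>m\<^sup>2\<close>, against \<open>m\<^sup>3\<close> for \<open>(m - 1) S\<close>. The constant comes from the bound \<open>4\<close>
  on the degenerate kernel.\<close>

lemma square_integrable_R: "integrable M (\<lambda>\<omega>. (R m \<omega>)\<^sup>2)"
  and expectation_R_square_le: "expectation (\<lambda>\<omega>. (R m \<omega>)\<^sup>2) \<le> 16 * (real m)\<^sup>2"
proof -
  let ?D = "\<lambda>q \<omega>. degenerate_part (X (fst q) \<omega>) (X (snd q) \<omega>)"
  let ?T = "\<lambda>q r \<omega>. ?D q \<omega> * ?D r \<omega>"
  have eq: "(R m \<omega>)\<^sup>2 = (\<Sum>q\<in>index_pairs m. \<Sum>r\<in>index_pairs m. ?T q r \<omega>)" for \<omega>
    by (simp add: R_def power2_eq_square sum_product split_beta')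
  have int: "integrable M (?T q r)" if "q \<in> index_pairs m" "r \<in> index_pairs m" for q r
    by (rule integrable_product[where A = 4 and B = 4])
       (use that abs_degenerate_part_le in \<open>auto simp: index_pairs_def\<close>)
  have T: "expectation (?T q r) \<le> (if q = r then 16 else 0)"
    if qr: "q \<in> index_pairs m" "r \<in> index_pairs m" for q r
  proof (cases "q = r")
    case True
    have "\<bar>?T q q \<omega>\<bar> \<le> 4 * 4" for \<omega>
      unfolding abs_mult by (intro mult_mono abs_degenerate_part_le) auto
    then have "?T q q \<omega> \<le> 16" for \<omega>
      using abs_le_D1 by fastforce
    then have "expectation (?T q q) \<le> expectation (\<lambda>_. 16)"
      by (intro integral_mono int qr) auto
    with True show ?thesis by (simp add: prob_space)
  next
    case False
    have "expectation (?T q r) = 0"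
      by (rule degenerate_fresh_eq_0[where B = 4])
         (use qr False abs_degenerate_part_le in \<open>auto simp: index_pairs_def\<close>)
    with False show ?thesis by simp
  qed
  show "integrable M (\<lambda>\<omega>. (R m \<omega>)\<^sup>2)"
    unfolding eq by (intro Bochner_Integration.integrable_sum int)
  have "expectation (\<lambda>\<omega>. (R m \<omega>)\<^sup>2) = (\<Sum>q\<in>index_pairs m. \<Sum>r\<in>index_pairs m. expectation (?T q r))"
    unfolding eq
    by (subst Bochner_Integration.integral_sum;
        (intro sum.cong refl Bochner_Integration.integral_sum Bochner_Integration.integrable_sum int)?) auto
  also have "\<dots> \<le> (\<Sum>q\<in>index_pairs m. \<Sum>r\<in>index_pairs m. if q = r then 16 else 0)"
    by (intro sum_mono T)
  also have "\<dots> = 16 * real (card (index_pairs m))" by simp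
  also have "real (card (index_pairs m)) \<le> (real m)\<^sup>2"
    using of_nat_mono[OF card_index_pairs_le[of m], where 'a = real] by simp
  finally show "expectation (\<lambda>\<omega>. (R m \<omega>)\<^sup>2) \<le> 16 * (real m)\<^sup>2" by simp
qed

lemma expectation_combination_square:
  "integrable M (\<lambda>\<omega>. (\<alpha> * S m \<omega> + \<beta> * R m \<omega>)\<^sup>2)"
  "expectation (\<lambda>\<omega>. (\<alpha> * S m \<omega> + \<beta> * R m \<omega>)\<^sup>2) =
     \<alpha>\<^sup>2 * (real m * \<sigma>2) + \<beta>\<^sup>2 * expectation (\<lambda>\<omega>. (R m \<omega>)\<^sup>2)"
proof -
  have eq: "(\<alpha> * S m \<omega> + \<beta> * R m \<omega>)\<^sup>2 =
      \<alpha>\<^sup>2 * (S m \<omega>)\<^sup>2 + 2 * \<alpha> * \<beta> * (S m \<omega> * R m \<omega>) + \<beta>\<^sup>2 * (R m \<omega>)\<^sup>2" for \<omega>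
    by (simp add: power2_eq_square algebra_simps)
  note int = square_integrable_S square_integrable_R integrable_S_R
  show "integrable M (\<lambda>\<omega>. (\<alpha> * S m \<omega> + \<beta> * R m \<omega>)\<^sup>2)"
    unfolding eq by (intro Bochner_Integration.integrable_add integrable_mult_right int)
  show "expectation (\<lambda>\<omega>. (\<alpha> * S m \<omega> + \<beta> * R m \<omega>)\<^sup>2) =
     \<alpha>\<^sup>2 * (real m * \<sigma>2) + \<beta>\<^sup>2 * expectation (\<lambda>\<omega>. (R m \<omega>)\<^sup>2)"
    unfolding eq using int by (simp add: expectation_S_square expectation_S_R)
qed

lemma U_centred: "U m \<omega> - expectation (U m) = (real m - 1) * S m \<omega> + R m \<omega>"
proof -
  have "expectation (U m) = real (card (index_pairs m)) * kernel_mean"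
    unfolding U_decomposition using integrable_S integrable_R
    by (simp add: expectation_S expectation_R prob_space)
  then show ?thesis by (simp add: U_decomposition)
qed

lemma variance_U:
  "variance (U m) = (real m - 1)\<^sup>2 * (real m * \<sigma>2) + expectation (\<lambda>\<omega>. (R m \<omega>)\<^sup>2)"
  unfolding U_centred using expectation_combination_square(2)[of "real m - 1" m 1] by simp

end

section \<open>Gaussian approximation of characteristic functions\<close>

lemma cmod_iexp_diff_le: "cmod (iexp x - iexp y) \<le> \<bar>x - y\<bar>"
proof -
  have "iexp x - iexp y = iexp y * (iexp (x - y) - 1)"
    by (simp add: algebra_simps exp_add[symmetric])
  then have "cmod (iexp x - iexp y) = cmod (iexp (x - y) - 1)"
    by (simp add: norm_mult)
  also have "\<dots> \<le> \<bar>x - y\<bar>"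
    using iexp_approx1[of "x - y" 0] by simp
  finally show ?thesis .
qed

text \<open>Replaces an appeal to Slutsky's theorem by a quantitative estimate, which is what a triangular
  array needs: closeness in mean square gives closeness of characteristic functions.\<close>

lemma (in prob_space) cmod_char_diff_le:
  assumes [measurable]: "W \<in> borel_measurable M" "Z \<in> borel_measurable M"
    and int: "integrable M (\<lambda>\<omega>. (W \<omega> - Z \<omega>)\<^sup>2)"
  shows "cmod (char (distr M borel W) t - char (distr M borel Z) t)
     \<le> \<bar>t\<bar> * sqrt (expectation (\<lambda>\<omega>. (W \<omega> - Z \<omega>)\<^sup>2))"
proof -
  let ?D = "\<lambda>\<omega>. \<bar>W \<omega> - Z \<omega>\<bar>"
  have int': "integrable M ?D"
    by (rule square_integrable_imp_integrable) (use int in auto)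
  have int_exp: "integrable M (\<lambda>\<omega>. iexp (t * V \<omega>))" if [measurable]: "V \<in> borel_measurable M" for V
    by (intro integrable_iexp) auto
  have "char (distr M borel W) t - char (distr M borel Z) t = (CLINT \<omega>|M. iexp (t * W \<omega>) - iexp (t * Z \<omega>))"
    using int_exp[of W] int_exp[of Z] by (simp add: char_def integral_distr)
  also have "cmod \<dots> \<le> expectation (\<lambda>\<omega>. cmod (iexp (t * W \<omega>) - iexp (t * Z \<omega>)))"
    by (rule integral_norm_bound)
  also have "\<dots> \<le> expectation (\<lambda>\<omega>. \<bar>t\<bar> * ?D \<omega>)"
  proof (rule integral_mono)
    show "integrable M (\<lambda>\<omega>. cmod (iexp (t * W \<omega>) - iexp (t * Z \<omega>)))"
      by (intro integrable_norm Bochner_Integration.integrable_diff int_exp) auto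
    show "cmod (iexp (t * W \<omega>) - iexp (t * Z \<omega>)) \<le> \<bar>t\<bar> * ?D \<omega>" for \<omega>
      using cmod_iexp_diff_le[of "t * W \<omega>" "t * Z \<omega>"]
      by (simp add: abs_mult[symmetric] right_diff_distrib)
  qed (use int' in auto)
  also have "\<dots> = \<bar>t\<bar> * expectation ?D" by simp
  \<comment> \<open>The variance of \<open>?D\<close> is non-negative.\<close>
  also have "(expectation ?D)\<^sup>2 \<le> expectation (\<lambda>\<omega>. (?D \<omega>)\<^sup>2)"
    using variance_eq[OF int'] variance_positive[of ?D] int by simp
  then have "expectation ?D \<le> sqrt (expectation (\<lambda>\<omega>. (W \<omega> - Z \<omega>)\<^sup>2))"
    by (intro real_le_rsqrt) simp
  finally show ?thesis by (simp add: mult_left_mono)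
qed

context kernel_sample
begin

lemma measurable_U: "U m \<in> borel_measurable M"
  unfolding U_def split_beta'
  by (intro borel_measurable_sum borel_measurable_X2) (auto simp: index_pairs_def)

text \<open>Both standardised variables have variance one, so the mean square of their difference is
  \<open>2 - 2 q\<close>, where \<open>q\<close> is their correlation. By orthogonality \<open>1 - q\<^sup>2\<close> is the share of \<open>R\<close> in the
  variance of \<open>U\<close>, which is at most of order \<open>1 / (m \<sigma>2)\<close>.\<close>

lemma expectation_U_S_difference_le:
  assumes m: "2 \<le> m" and pos: "0 < \<sigma>2"
  defines "D \<equiv> \<lambda>\<omega>. (U m \<omega> - expectation (U m)) / sqrt (variance (U m)) - S m \<omega> / sqrt (real m * \<sigma>2)"
  shows "integrable M (\<lambda>\<omega>. (D \<omega>)\<^sup>2)"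
    and "expectation (\<lambda>\<omega>. (D \<omega>)\<^sup>2) \<le> 32 * real m / ((real m - 1)\<^sup>2 * \<sigma>2)"
proof -
  define s where "s = sqrt (real m * \<sigma>2)"
  define d where "d = sqrt (variance (U m))"
  define r where "r = expectation (\<lambda>\<omega>. (R m \<omega>)\<^sup>2)"
  define q where "q = (real m - 1) * s / d"
  have r: "0 \<le> r" "r \<le> 16 * (real m)\<^sup>2"
    using expectation_R_square_le by (simp_all add: r_def)
  have s: "0 < s" "s\<^sup>2 = real m * \<sigma>2"
    using m pos by (simp_all add: s_def)
  have d2: "d\<^sup>2 = (real m - 1)\<^sup>2 * s\<^sup>2 + r"
    using variance_positive[of "U m"] by (simp add: d_def s variance_U[of m, folded r_def])
  have ms: "0 < (real m - 1)\<^sup>2 * s\<^sup>2"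
    using m s(1) by (intro mult_pos_pos) auto
  then have "0 < d\<^sup>2" using r unfolding d2 by linarith
  then have d: "0 < d" by (simp add: d_def)
  have D: "D \<omega> = ((real m - 1) / d - 1 / s) * S m \<omega> + 1 / d * R m \<omega>" for \<omega>
    using s d unfolding D_def s_def[symmetric] d_def[symmetric] unfolding U_centred
    by (simp add: field_simps)
  show "integrable M (\<lambda>\<omega>. (D \<omega>)\<^sup>2)"
    unfolding D by (rule expectation_combination_square)
  have q2: "q\<^sup>2 + r / d\<^sup>2 = 1"
    using \<open>0 < d\<^sup>2\<close> by (simp add: q_def power_divide power_mult_distrib add_divide_distrib[symmetric] d2[symmetric])
  have q0: "0 \<le> q" using m s d by (simp add: q_def)
  have "0 \<le> r / d\<^sup>2" using r by simp
  then have "q\<^sup>2 \<le> 1" using q2 by linarith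
  then have q1: "q \<le> 1" using q0 by (simp add: power_le_one_iff abs_square_le_1)
  have "expectation (\<lambda>\<omega>. (D \<omega>)\<^sup>2) = ((real m - 1) / d - 1 / s)\<^sup>2 * s\<^sup>2 + (1 / d)\<^sup>2 * r"
    unfolding D expectation_combination_square(2) s(2) r_def ..
  also have "\<dots> = (((real m - 1) / d - 1 / s) * s)\<^sup>2 + r / d\<^sup>2"
    by (simp add: power_mult_distrib power_divide)
  also have "((real m - 1) / d - 1 / s) * s = q - 1"
    using s by (simp add: q_def left_diff_distrib)
  also have "(q - 1)\<^sup>2 + r / d\<^sup>2 = 2 - 2 * q"
    using q2 by (simp add: power2_diff)
  also have "\<dots> \<le> 2 - 2 * q\<^sup>2"
    using q0 q1 by (simp add: power2_eq_square mult_left_le)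
  also have "\<dots> = 2 * (r / d\<^sup>2)"
    using q2 by simp
  also have "\<dots> \<le> 2 * (16 * (real m)\<^sup>2 / ((real m - 1)\<^sup>2 * s\<^sup>2))"
    using r ms by (intro mult_left_mono frac_le) (simp_all add: d2)
  also have "\<dots> = 32 * real m / ((real m - 1)\<^sup>2 * \<sigma>2)"
    using m unfolding s(2) by (simp add: power2_eq_square[of "real m"])
  finally show "expectation (\<lambda>\<omega>. (D \<omega>)\<^sup>2) \<le> 32 * real m / ((real m - 1)\<^sup>2 * \<sigma>2)" .
qed

text \<open>The classical argument for independent summands, with an explicit error. The summands are bounded
  by one, so their absolute third moment is at most \<open>\<sigma>2\<close>; hence the error depends on the law \<open>p\<close>
  and on the kernel through \<open>\<sigma>2\<close> only.\<close>

lemma char_S_le: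
  assumes m: "1 \<le> m" "t\<^sup>2 / 4 \<le> real m" and pos: "0 < \<sigma>2"
  shows "cmod (char (distr M borel (\<lambda>\<omega>. S m \<omega> / sqrt (real m * \<sigma>2))) t - (1 + (- (t\<^sup>2) / 2) / real m) ^ m)
     \<le> \<bar>t\<bar> ^ 3 / (6 * sqrt (real m * \<sigma>2))"
proof -
  let ?s = "sqrt (real m * \<sigma>2)"
  let ?t = "t / ?s"
  let ?Y = "\<lambda>i \<omega>. linear_part (X i \<omega>)"
  let ?e = "1 + (- (t\<^sup>2) / 2) / real m"
  define \<psi> where "\<psi> = char (distr (measure_pmf p) borel linear_part) ?t"
  have s: "0 < ?s" "?s\<^sup>2 = real m * \<sigma>2" using m pos by simp_all
  have factor: "char (distr M borel (\<lambda>\<omega>. ?Y i \<omega> / ?s)) t = \<psi>" if "i \<in> {1..m}" for i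
  proof -
    have i: "1 \<le> i" using that by simp
    have meas: "?Y i \<in> borel_measurable M" by (rule measurable_compose[OF measurable_X[OF i]]) simp
    have "char (distr M borel (\<lambda>\<omega>. ?Y i \<omega> / ?s)) t = (CLINT \<omega>|M. iexp (?t * ?Y i \<omega>))"
      unfolding char_def using meas by (subst integral_distr) auto
    also have "\<dots> = (CLINT x|distr M (count_space UNIV) (X i). iexp (?t * linear_part x))"
      by (rule integral_distr[symmetric]) (use measurable_X[OF i] in auto)
    also have "\<dots> = \<psi>"
      unfolding \<psi>_def char_def distr_X[OF i] by (subst integral_distr) auto
    finally show ?thesis .
  qed
  have indep_Y: "indep_vars (\<lambda>_. borel) (\<lambda>i \<omega>. ?Y i \<omega> / ?s) {1..m}"
    by (rule indep_vars_compose2[where M' = "\<lambda>_. count_space UNIV" and X = X])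
       (auto intro: indep_vars_subset[OF indep_X])
  have "char (distr M borel (\<lambda>\<omega>. S m \<omega> / ?s)) t = char (distr M borel (\<lambda>\<omega>. \<Sum>i=1..m. ?Y i \<omega> / ?s)) t"
    by (simp add: S_def sum_divide_distrib)
  also have "\<dots> = (\<Prod>i=1..m. char (distr M borel (\<lambda>\<omega>. ?Y i \<omega> / ?s)) t)"
    by (rule char_distr_sum[OF indep_Y])
  also have "\<dots> = \<psi> ^ m"
    by (simp add: factor)
  finally have char_eq: "char (distr M borel (\<lambda>\<omega>. S m \<omega> / ?s)) t = \<psi> ^ m" .
  interpret L: real_distribution "distr (measure_pmf p) borel linear_part"
    by (rule prob_space.real_distribution_distr[OF measure_pmf.prob_space_axioms]) simp
  have int2: "integrable (measure_pmf p) (\<lambda>x. (linear_part x)\<^sup>2)"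
    by (intro measure_pmf.integrable_const_bound[where B = 1]) (auto simp: abs_linear_part_le abs_square_le_1)
  have cube: "\<bar>linear_part x\<bar> ^ 3 \<le> (linear_part x)\<^sup>2" for x
    using mult_right_mono[OF abs_linear_part_le[of x], of "\<bar>linear_part x\<bar>\<^sup>2"]
    by (simp add: power3_eq_cube power2_eq_square abs_mult_self_eq mult.assoc)
  have "cmod (\<psi> - (1 - ?t\<^sup>2 * \<sigma>2 / 2)) \<le>
      ?t\<^sup>2 / 6 * measure_pmf.expectation p (\<lambda>x. min (6 * (linear_part x)\<^sup>2) (\<bar>?t\<bar> * \<bar>linear_part x\<bar> ^ 3))"
    unfolding \<psi>_def
    by (rule prob_space.char_approx3'[OF measure_pmf.prob_space_axioms]) (use int2 in \<open>simp_all add: integrable_linear_part expectation_linear_part \<sigma>2_eq\<close>)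
  also have "measure_pmf.expectation p (\<lambda>x. min (6 * (linear_part x)\<^sup>2) (\<bar>?t\<bar> * \<bar>linear_part x\<bar> ^ 3))
      \<le> measure_pmf.expectation p (\<lambda>x. \<bar>?t\<bar> * (linear_part x)\<^sup>2)"
  proof (rule integral_mono)
    show "integrable (measure_pmf p) (\<lambda>x. min (6 * (linear_part x)\<^sup>2) (\<bar>?t\<bar> * \<bar>linear_part x\<bar> ^ 3))"
      by (rule Bochner_Integration.integrable_bound[of _ "\<lambda>x. 6 * (linear_part x)\<^sup>2"]) (use int2 in auto)
    show "min (6 * (linear_part x)\<^sup>2) (\<bar>?t\<bar> * \<bar>linear_part x\<bar> ^ 3) \<le> \<bar>?t\<bar> * (linear_part x)\<^sup>2" for x
      using mult_left_mono[OF cube[of x], of "\<bar>?t\<bar>"] by linarith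
  qed (use int2 in auto)
  also have "measure_pmf.expectation p (\<lambda>x. \<bar>?t\<bar> * (linear_part x)\<^sup>2) = \<bar>?t\<bar> * \<sigma>2"
    by (simp add: \<sigma>2_eq)
  also have "1 - ?t\<^sup>2 * \<sigma>2 / 2 = ?e"
    using pos m by (simp add: power_divide)
  finally have approx: "cmod (\<psi> - ?e) \<le> ?t\<^sup>2 / 6 * (\<bar>?t\<bar> * \<sigma>2)"
    by (simp add: mult_left_mono)
  have "cmod (\<psi> ^ m - complex_of_real ?e ^ m) \<le> real m * cmod (\<psi> - complex_of_real ?e)"
  proof (rule norm_power_diff)
    show "cmod \<psi> \<le> 1" unfolding \<psi>_def by (rule L.cmod_char_le_1)
    \<comment> \<open>This is where \<open>m\<close> has to be large compared with \<open>t\<^sup>2\<close>.\<close>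
    have "\<bar>?e\<bar> \<le> 1" using m by (intro abs_leI) (auto simp: field_simps)
    then show "cmod (complex_of_real ?e) \<le> 1" by (simp only: norm_of_real)
  qed
  also have "\<dots> \<le> real m * (?t\<^sup>2 / 6 * (\<bar>?t\<bar> * \<sigma>2))"
    using approx by (intro mult_left_mono) auto
  also have "\<dots> = \<bar>t\<bar> ^ 3 / (6 * ?s)"
  proof -
    have "real m * ((t / u)\<^sup>2 / 6 * (\<bar>t / u\<bar> * \<sigma>2)) = \<bar>t\<bar> ^ 3 / (6 * u)"
      if u: "0 < u" "u\<^sup>2 = real m * \<sigma>2" for u
    proof -
      have "real m * ((t / u)\<^sup>2 / 6 * (\<bar>t / u\<bar> * \<sigma>2)) = (\<bar>t\<bar> / u) ^ 3 * (real m * \<sigma>2) / 6"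
        using u(1) by (simp add: ac_simps power3_eq_cube power2_eq_square power_divide abs_divide)
      also have "\<dots> = (\<bar>t\<bar> / u) ^ 3 * u\<^sup>2 / 6" by (simp only: u(2))
      also have "\<dots> = \<bar>t\<bar> ^ 3 / (6 * u)"
        using u(1) by (simp add: power3_eq_cube power2_eq_square)
      finally show ?thesis .
    qed
    from this[OF s] show ?thesis .
  qed
  finally show ?thesis unfolding char_eq by simp
qed

text \<open>The bound involves the law of the sample only through a lower bound \<open>c\<close> on \<open>\<sigma>2\<close>, so it applies
  uniformly along a sequence of laws.\<close>

lemma char_standardized_U_le:
  assumes m: "2 \<le> m" "t\<^sup>2 / 4 \<le> real m" and c: "0 < c" "c \<le> \<sigma>2"
  shows "cmod (char (distr M borel (standardized M (U m))) t - (1 + (- (t\<^sup>2) / 2) / real m) ^ m)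
     \<le> \<bar>t\<bar> * sqrt (32 * real m / ((real m - 1)\<^sup>2 * c)) + \<bar>t\<bar> ^ 3 / (6 * sqrt (real m * c))"
proof -
  let ?Z = "\<lambda>\<omega>. S m \<omega> / sqrt (real m * \<sigma>2)"
  let ?e = "complex_of_real ((1 + (- (t\<^sup>2) / 2) / real m) ^ m)"
  have pos: "0 < \<sigma>2" using c by linarith
  have meas: "standardized M (U m) \<in> borel_measurable M" "?Z \<in> borel_measurable M"
    using measurable_U[of m] borel_measurable_integrable[OF integrable_S[of m]]
    by (auto simp: standardized_def[abs_def])
  have "cmod (char (distr M borel (standardized M (U m))) t - char (distr M borel ?Z) t) \<le>
      \<bar>t\<bar> * sqrt (expectation (\<lambda>\<omega>. (standardized M (U m) \<omega> - ?Z \<omega>)\<^sup>2))"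
    using expectation_U_S_difference_le(1)[OF m(1) pos]
    by (intro cmod_char_diff_le meas) (simp add: standardized_def)
  also have "\<dots> \<le> \<bar>t\<bar> * sqrt (32 * real m / ((real m - 1)\<^sup>2 * \<sigma>2))"
    using expectation_U_S_difference_le(2)[OF m(1) pos]
    by (intro mult_left_mono real_sqrt_le_mono) (simp_all add: standardized_def)
  also have "\<dots> \<le> \<bar>t\<bar> * sqrt (32 * real m / ((real m - 1)\<^sup>2 * c))"
    using m c by (intro mult_left_mono real_sqrt_le_mono divide_left_mono mult_pos_pos) auto
  finally have 1: "cmod (char (distr M borel (standardized M (U m))) t - char (distr M borel ?Z) t) \<le> \<dots>" .
  have "cmod (char (distr M borel ?Z) t - ?e) \<le> \<bar>t\<bar> ^ 3 / (6 * sqrt (real m * \<sigma>2))"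
    using char_S_le[of m t] m pos by simp
  also have "\<dots> \<le> \<bar>t\<bar> ^ 3 / (6 * sqrt (real m * c))"
    using m c by (intro divide_left_mono mult_left_mono real_sqrt_le_mono mult_pos_pos) auto
  finally have 2: "cmod (char (distr M borel ?Z) t - ?e) \<le> \<dots>" .
  show ?thesis
    using norm_triangle_mono[OF 1 2] by simp
qed

end

section \<open>Uniform non-degeneracy of the coprimality kernel\<close>

definition coprime_kernel :: "nat \<Rightarrow> nat \<Rightarrow> real" where
  "coprime_kernel x y = of_bool (gcd x y = 1)"

text \<open>The first projection of the coprimality kernel under the uniform law on \<open>{1..n}\<close>.\<close>

definition coprime_fraction :: "nat \<Rightarrow> nat \<Rightarrow> real" where
  "coprime_fraction n x = real (card {y \<in> {1..n}. coprime x y}) / real n"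

text \<open>The comparison \<open>1 / (2 k + 1)\<^sup>2 < 1 / (4 k (k + 1))\<close> telescopes to the bound \<open>1 / 4\<close>. Keeping the
  first term \<open>1 / 9\<close> exact instead of replacing it by \<open>1 / 8\<close> saves \<open>1 / 72\<close>. This strict gain
  matters: together with the prime 2 the bound \<open>1 / 4\<close> would only give that at least half of all
  pairs are coprime, while even numbers are coprime to about half of \<open>{1..n}\<close>.\<close>

lemma sum_inverse_odd_squares_le: "(\<Sum>k=1..K. 1 / (2 * real k + 1)\<^sup>2) \<le> 17 / 72"
proof -
  have "(\<Sum>k=1..Suc K. 1 / (2 * real k + 1)\<^sup>2) \<le> 17 / 72 - 1 / (4 * (real K + 2))" for K
  proof (induction K)
    case 0
    then show ?case by (simp add: power2_eq_square)
  next
    case (Suc K)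
    have "1 / (2 * real (Suc (Suc K)) + 1)\<^sup>2 \<le> 1 / (4 * ((real K + 2) * (real K + 3)))"
      by (intro divide_left_mono) (simp_all add: power2_eq_square algebra_simps add_pos_nonneg)
    also have "\<dots> = 1 / (4 * (real K + 2)) - 1 / (4 * (real K + 3))"
    proof -
      have "1 / (4 * (a * (a + 1))) = 1 / (4 * a) - 1 / (4 * (a + 1))" if "0 < a" for a :: real
        using that by (simp add: field_simps)
      from this[of "real K + 2"] show ?thesis by (simp add: ac_simps)
    qed
    finally show ?case using Suc.IH by (simp add: algebra_simps)
  qed
  \<comment> \<open>The induction starts at one term, where the bound is an equality; the empty sum is covered by
    monotonicity.\<close>
  note this[of "K - 1"]
  moreover have "0 \<le> 1 / (4 * (real (K - 1) + 2))" by simp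
  ultimately have "(\<Sum>k=1..Suc (K - 1). 1 / (2 * real k + 1)\<^sup>2) \<le> 17 / 72" by linarith
  then show ?thesis by (cases K) simp_all
qed

lemma card_multiples: "card {x \<in> {1..n}. d dvd x} \<le> n div d" if "0 < d" for d n :: nat
proof -
  have "{x \<in> {1..n}. d dvd x} \<subseteq> (\<lambda>q. d * q) ` {1..n div d}"
  proof
    fix x assume x: "x \<in> {x \<in> {1..n}. d dvd x}"
    then obtain q where q: "x = d * q" by (auto elim: dvdE)
    with x that have "q \<le> n div d" "1 \<le> q"
      by (auto simp: less_eq_div_iff_mult_less_eq mult.commute Suc_le_eq)
    with q show "x \<in> (\<lambda>q. d * q) ` {1..n div d}" by auto
  qed
  from surj_card_le[OF _ this] show ?thesis by simp
qed

text \<open>A pair that is not coprime has a common prime factor, which is 2 or an odd number \<open>2 k + 1\<close> with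
  \<open>k \<ge> 1\<close>. The union bound over all these divisors, prime or not, costs
  \<open>1 / 4 + 17 / 72 = 35 / 72\<close>.\<close>

lemma card_non_coprime_le:
  "real (card {(x, y). x \<in> {1..n} \<and> y \<in> {1..n} \<and> \<not> coprime x y}) \<le> 35 / 72 * (real n)\<^sup>2"
proof -
  define d where "d k = (if k = 0 then 2 else 2 * k + 1)" for k :: nat
  let ?A = "\<lambda>d. {x \<in> {1..n}. d dvd x}"
  have "{(x, y). x \<in> {1..n} \<and> y \<in> {1..n} \<and> \<not> coprime x y} \<subseteq> (\<Union>k\<in>{0..n}. ?A (d k) \<times> ?A (d k))"
  proof clarify
    fix x y assume xy: "x \<in> {1..n}" "y \<in> {1..n}" "\<not> coprime x y"
    then have "gcd x y \<noteq> 1" by (simp add: coprime_iff_gcd_eq_1)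
    then obtain q where q: "prime q" "q dvd gcd x y" using prime_factor_nat by blast
    then have dvd: "q dvd x" "q dvd y" by simp_all
    then have "q \<le> n" using xy dvd_imp_le[of q x] by auto
    moreover have "\<exists>k. q = d k \<and> k \<le> q"
    proof (cases "q = 2")
      case True
      then show ?thesis by (intro exI[of _ 0]) (simp add: d_def)
    next
      case False
      with q have "odd q" using prime_odd_nat prime_ge_2_nat[of q] by auto
      then obtain k where k: "q = 2 * k + 1" by (auto elim: oddE)
      with q have "k \<noteq> 0" by (intro notI) simp
      with k show ?thesis by (intro exI[of _ k]) (simp add: d_def)
    qed
    ultimately obtain k where k: "q = d k" "k \<in> {0..n}" by auto
    with xy dvd have "(x, y) \<in> ?A (d k) \<times> ?A (d k)" by simp
    with k show "(x, y) \<in> (\<Union>k\<in>{0..n}. ?A (d k) \<times> ?A (d k))" by blast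
  qed
  then have "card {(x, y). x \<in> {1..n} \<and> y \<in> {1..n} \<and> \<not> coprime x y} \<le>
      card (\<Union>k\<in>{0..n}. ?A (d k) \<times> ?A (d k))"
    by (intro card_mono) auto
  also have "\<dots> \<le> (\<Sum>k\<in>{0..n}. card (?A (d k) \<times> ?A (d k)))"
    by (rule card_UN_le) simp
  finally have "real (card {(x, y). x \<in> {1..n} \<and> y \<in> {1..n} \<and> \<not> coprime x y}) \<le>
      real (\<Sum>k\<in>{0..n}. card (?A (d k) \<times> ?A (d k)))"
    by (rule of_nat_mono)
  also have "\<dots> = (\<Sum>k\<in>{0..n}. (real (card (?A (d k))))\<^sup>2)"
    unfolding of_nat_sum card_cartesian_product of_nat_mult power2_eq_square ..
  also have "\<dots> \<le> (\<Sum>k\<in>{0..n}. (real n)\<^sup>2 * (1 / (real (d k))\<^sup>2))"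
  proof (rule sum_mono)
    fix k
    have "real (card (?A (d k))) \<le> real n / real (d k)"
    proof -
      have "real (card (?A (d k))) \<le> real (n div d k)"
        by (intro of_nat_mono card_multiples) (simp add: d_def)
      also have "\<dots> \<le> real n / real (d k)" by (rule of_nat_div_le_of_nat)
      finally show ?thesis .
    qed
    then have "(real (card (?A (d k))))\<^sup>2 \<le> (real n / real (d k))\<^sup>2"
      by (rule power_mono) simp
    then show "(real (card (?A (d k))))\<^sup>2 \<le> (real n)\<^sup>2 * (1 / (real (d k))\<^sup>2)"
      by (simp add: power_divide)
  qed
  also have "\<dots> = (real n)\<^sup>2 * (1 / 4 + (\<Sum>k=1..n. 1 / (2 * real k + 1)\<^sup>2))"
    by (simp add: sum_distrib_left distrib_left sum.atLeast_Suc_atMost[of 0] d_def add.commute)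
  also have "\<dots> \<le> (real n)\<^sup>2 * (35 / 72)"
    using sum_inverse_odd_squares_le[of n] by (intro mult_left_mono) auto
  finally show ?thesis by simp
qed

lemma mean_coprime_fraction_ge:
  assumes "1 \<le> n"
  shows "37 / 72 \<le> (\<Sum>x=1..n. coprime_fraction n x) / real n"
proof -
  let ?N = "{(x, y). x \<in> {1..n} \<and> y \<in> {1..n} \<and> \<not> coprime x y}"
  have "card ?N = card ({1..n} \<times> {1..n} - Sigma {1..n} (\<lambda>x. {y \<in> {1..n}. coprime x y}))"
    by (rule arg_cong[of _ _ card]) auto
  also have "\<dots> = card ({1..n} \<times> {1..n}) - card (Sigma {1..n} (\<lambda>x. {y \<in> {1..n}. coprime x y}))"
    by (rule card_Diff_subset) auto
  finally have "card ?N = n * n - (\<Sum>x=1..n. card {y \<in> {1..n}. coprime x y})"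
    by (simp add: card_cartesian_product)
  then have "real n * real n \<le> real (card ?N) + (\<Sum>x=1..n. real (card {y \<in> {1..n}. coprime x y}))"
    by (simp flip: of_nat_mult of_nat_sum of_nat_add)
  moreover have "(\<Sum>x=1..n. coprime_fraction n x) / real n =
      (\<Sum>x=1..n. real (card {y \<in> {1..n}. coprime x y})) / (real n)\<^sup>2"
    by (simp add: coprime_fraction_def sum_divide_distrib[symmetric] power2_eq_square)
  moreover have "37 / 72 * (real n)\<^sup>2 \<le> A"
    if "real n * real n \<le> real (card ?N) + A" for A
    using that card_non_coprime_le[of n] unfolding power2_eq_square by linarith
  ultimately show ?thesis
    using assms by (simp add: pos_le_divide_eq)
qed

lemma coprime_fraction_even_le:
  assumes "1 \<le> n" "even x"
  shows "coprime_fraction n x \<le> 1 / 2 + 1 / (2 * real n)"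
proof -
  have "{y \<in> {1..n}. coprime x y} \<subseteq> (\<lambda>k. 2 * k + 1) ` {..<(n + 1) div 2}"
  proof
    fix y assume y: "y \<in> {y \<in> {1..n}. coprime x y}"
    have "odd y"
    proof
      assume "even y"
      with assms y have "is_unit (2 :: nat)" by (blast intro: coprime_common_divisor)
      then show False by simp
    qed
    then obtain k where "y = 2 * k + 1" by (auto elim: oddE)
    with y show "y \<in> (\<lambda>k. 2 * k + 1) ` {..<(n + 1) div 2}" by auto
  qed
  from surj_card_le[OF _ this] have "card {y \<in> {1..n}. coprime x y} \<le> (n + 1) div 2" by simp
  then have "2 * card {y \<in> {1..n}. coprime x y} \<le> n + 1" by linarith
  then have "2 * real (card {y \<in> {1..n}. coprime x y}) \<le> real n + 1"
    by (simp flip: of_nat_add of_nat_mult of_nat_Suc)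
  with assms show ?thesis by (simp add: coprime_fraction_def field_simps)
qed

text \<open>For large \<open>n\<close> the even numbers, at least a third of \<open>{1..n}\<close>, are coprime to at most the fraction
  \<open>1 / 2 + 1 / 144\<close>, while the mean fraction is at least \<open>37 / 72 = 1 / 2 + 2 / 144\<close>. For \<open>n < 72\<close> it is
  enough that 1 is coprime to everything and \<open>n\<close> is not coprime to itself. The constant is
  \<open>1 / (2 * 72^3)\<close>, which is below both resulting bounds.\<close>

lemma variance_coprime_fraction_ge:
  assumes n: "2 \<le> n"
  defines "\<mu> \<equiv> (\<Sum>x=1..n. coprime_fraction n x) / real n"
  shows "1 / 746496 \<le> (\<Sum>x=1..n. (coprime_fraction n x - \<mu>)\<^sup>2) / real n"
proof (cases "72 \<le> n")
  case True
  have \<mu>: "37 / 72 \<le> \<mu>" unfolding \<mu>_def using n by (intro mean_coprime_fraction_ge) simp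
  let ?E = "(\<lambda>k. 2 * k) ` {1..n div 2}"
  have "n \<le> 3 * (n div 2)"
    using n by presburger
  then have "real n / 3 \<le> real (n div 2)"
    by linarith
  then have "real n / 3 * (1 / 144)\<^sup>2 \<le> real (card ?E) * (1 / 144)\<^sup>2"
    by (intro mult_right_mono) (simp_all add: card_image inj_on_def)
  also have "\<dots> = (\<Sum>x\<in>?E. (1 / 144)\<^sup>2)" by simp
  also have "\<dots> \<le> (\<Sum>x\<in>?E. (coprime_fraction n x - \<mu>)\<^sup>2)"
  proof (rule sum_mono)
    fix x assume "x \<in> ?E"
    then have "coprime_fraction n x \<le> 1 / 2 + 1 / (2 * real n)"
      using n by (intro coprime_fraction_even_le) auto
    also have "1 / (2 * real n) \<le> 1 / 144" using True by (simp add: field_simps)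
    finally have "1 / 144 \<le> \<mu> - coprime_fraction n x" using \<mu> by simp
    then have "(1 / 144)\<^sup>2 \<le> (\<mu> - coprime_fraction n x)\<^sup>2" by (intro power_mono) auto
    then show "(1 / 144)\<^sup>2 \<le> (coprime_fraction n x - \<mu>)\<^sup>2" by (simp add: power2_commute)
  qed
  also have "\<dots> \<le> (\<Sum>x=1..n. (coprime_fraction n x - \<mu>)\<^sup>2)"
    by (intro sum_mono2) auto
  finally show ?thesis using n by (simp add: field_simps power2_eq_square)
next
  case False
  have "{y \<in> {1..n}. coprime 1 y} = {1..n}" by auto
  then have one: "coprime_fraction n 1 = 1" using n by (simp only: coprime_fraction_def) simp
  have "{y \<in> {1..n}. coprime n y} \<subseteq> {1..n} - {n}" using n by auto
  then have "card {y \<in> {1..n}. coprime n y} \<le> card ({1..n} - {n})" by (intro card_mono) auto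
  then have "card {y \<in> {1..n}. coprime n y} \<le> n - 1" using n by simp
  then have "card {y \<in> {1..n}. coprime n y} + 1 \<le> n" using n by linarith
  then have "real (card {y \<in> {1..n}. coprime n y}) + 1 \<le> real n"
    by (simp flip: of_nat_Suc)
  then have gap: "1 / real n \<le> 1 - coprime_fraction n n"
    using n by (simp add: coprime_fraction_def field_simps)
  have "1 / 71 \<le> 1 / real n" using False n by (intro divide_left_mono) auto
  with gap have "(1 / 71)\<^sup>2 \<le> (1 - coprime_fraction n n)\<^sup>2" by (intro power_mono) auto
  \<comment> \<open>Two values at distance \<open>\<delta>\<close> contribute at least \<open>\<delta>\<^sup>2 / 2\<close> to the sum of squares about any point.\<close>
  also have "\<dots> \<le> 2 * ((1 - \<mu>)\<^sup>2 + (coprime_fraction n n - \<mu>)\<^sup>2)"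
    using zero_le_power2[of "(1 - \<mu>) + (coprime_fraction n n - \<mu>)"]
    by (simp add: power2_eq_square algebra_simps)
  also have "(1 - \<mu>)\<^sup>2 + (coprime_fraction n n - \<mu>)\<^sup>2 = (\<Sum>x\<in>{1, n}. (coprime_fraction n x - \<mu>)\<^sup>2)"
    using n one by simp
  also have "\<dots> \<le> (\<Sum>x=1..n. (coprime_fraction n x - \<mu>)\<^sup>2)"
    using n by (intro sum_mono2) auto
  finally have "(1 / 71)\<^sup>2 / 2 / 71 \<le> (\<Sum>x=1..n. (coprime_fraction n x - \<mu>)\<^sup>2) / real n"
    using False n by (intro frac_le) (auto intro: sum_nonneg)
  then show ?thesis by (simp add: power2_eq_square)
qed

lemma first_projection_coprime_kernel:
  assumes "1 \<le> n"
  shows "first_projection (pmf_of_set {1..n}) coprime_kernel = coprime_fraction n"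
proof
  fix x
  show "first_projection (pmf_of_set {1..n}) coprime_kernel x = coprime_fraction n x"
    using assms
    by (simp add: first_projection_def integral_pmf_of_set coprime_kernel_def coprime_fraction_def
        coprime_iff_gcd_eq_1 sum_of_bool_eq Int_def conj_commute)
qed

lemma variance_first_projection_coprime_kernel_ge:
  assumes "2 \<le> n"
  shows "1 / 746496 \<le>
    measure_pmf.variance (pmf_of_set {1..n}) (first_projection (pmf_of_set {1..n}) coprime_kernel)"
proof -
  have "1 \<le> n" using assms by simp
  then show ?thesis
    unfolding first_projection_coprime_kernel[OF \<open>1 \<le> n\<close>]
    using variance_coprime_fraction_ge[OF assms] by (simp add: integral_pmf_of_set)
qed

section \<open>The number of coprime pairs\<close>

lemma kernel_sample_coprime:
  assumes "prob_space M" "prob_space.indep_vars M (\<lambda>_. count_space UNIV) X {1..}"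
    and "\<And>i. 1 \<le> i \<Longrightarrow> distr M (count_space UNIV) (X i) = measure_pmf p"
  shows "kernel_sample M X p coprime_kernel"
proof -
  interpret prob_space M by fact
  show ?thesis
    by unfold_locales (use assms in \<open>auto simp: coprime_kernel_def gcd.commute\<close>)
qed

text \<open>The error bound \<open>?b\<close> for the characteristic functions at \<open>t\<close> is the same for all choices of
  \<open>N m\<close> and tends to zero, so Levy's continuity theorem applies to any sequence of ranges.\<close>

lemma coprime_pairs_clt:
  fixes M :: "nat \<Rightarrow> 'a measure" and X :: "nat \<Rightarrow> nat \<Rightarrow> 'a \<Rightarrow> nat"
  assumes prob: "\<And>n. n \<ge> 1 \<Longrightarrow> prob_space (M n)"
    and indep: "\<And>n. n \<ge> 1 \<Longrightarrow> prob_space.indep_vars (M n) (\<lambda>_. count_space UNIV) (X n) {1..}"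
    and unif: "\<And>n i. n \<ge> 1 \<Longrightarrow> i \<ge> 1 \<Longrightarrow>
      distr (M n) (count_space UNIV) (X n i) = measure_pmf (pmf_of_set {1..n})"
    and N: "\<And>m. 2 \<le> N m"
  shows "weak_conv_m
    (\<lambda>m. distr (M (N m)) borel (standardized (M (N m)) (coprime_pairs (X (N m)) m)))
    std_normal_distribution"
proof (rule levy_continuity)
  let ?c = "1 / 746496 :: real"
  have sample: "kernel_sample (M (N m)) (X (N m)) (pmf_of_set {1..N m}) coprime_kernel" for m
    using N[of m] by (intro kernel_sample_coprime prob indep unif) auto
  have U: "coprime_pairs (X (N m)) m = kernel_sample.U (X (N m)) coprime_kernel m" for m
    by (intro ext) (simp add: coprime_pairs_def kernel_sample.U_def[OF sample] index_pairs_def coprime_kernel_def)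
  show "real_distribution (distr (M (N m)) borel (standardized (M (N m)) (coprime_pairs (X (N m)) m)))" for m
  proof -
    interpret kernel_sample "M (N m)" "X (N m)" "pmf_of_set {1..N m}" coprime_kernel by (rule sample)
    show ?thesis
      unfolding U using measurable_U[of m] by (intro real_distribution_distr) (simp add: standardized_def[abs_def])
  qed
  show "real_distribution std_normal_distribution" by (rule real_dist_normal_dist)
  fix t :: real
  let ?\<phi> = "\<lambda>m. char (distr (M (N m)) borel (standardized (M (N m)) (coprime_pairs (X (N m)) m))) t"
  let ?e = "\<lambda>m. complex_of_real ((1 + (- (t\<^sup>2) / 2) / real m) ^ m)"
  let ?b = "\<lambda>m. \<bar>t\<bar> * sqrt (32 * real m / ((real m - 1)\<^sup>2 * ?c)) + \<bar>t\<bar> ^ 3 / (6 * sqrt (real m * ?c))"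
  have "\<forall>\<^sub>F m in sequentially. cmod (?\<phi> m - ?e m) \<le> ?b m"
  proof (rule eventually_sequentiallyI)
    fix m assume "max 2 (nat \<lceil>t\<^sup>2 / 4\<rceil>) \<le> m"
    then have m: "2 \<le> m" "t\<^sup>2 / 4 \<le> real m" by (auto simp: nat_ceiling_le_eq)
    interpret kernel_sample "M (N m)" "X (N m)" "pmf_of_set {1..N m}" coprime_kernel by (rule sample)
    have "?c \<le> \<sigma>2"
      unfolding \<sigma>2_def by (rule variance_first_projection_coprime_kernel_ge[OF N])
    then show "cmod (?\<phi> m - ?e m) \<le> ?b m"
      unfolding U by (intro char_standardized_U_le[OF m]) simp
  qed
  moreover have "?b \<longlonglongrightarrow> 0"
    by real_asymp
  ultimately have "(\<lambda>m. ?\<phi> m - ?e m) \<longlonglongrightarrow> 0"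
    by (rule Lim_null_comparison)
  moreover have "?e \<longlonglongrightarrow> complex_of_real (exp (- (t\<^sup>2) / 2))"
    by (intro tendsto_of_real tendsto_exp_limit_sequentially)
  ultimately show "?\<phi> \<longlonglongrightarrow> char std_normal_distribution t"
    unfolding char_std_normal_distribution by (rule Lim_transform[rotated])
qed

theorem theorem1:
  fixes M :: "nat \<Rightarrow> 'a measure"
    and X :: "nat \<Rightarrow> nat \<Rightarrow> 'a \<Rightarrow> nat"
  assumes prob: "\<And>n. n \<ge> 1 \<Longrightarrow> prob_space (M n)"
    and indep: "\<And>n. n \<ge> 1 \<Longrightarrow> prob_space.indep_vars (M n) (\<lambda>_. count_space UNIV) (X n) {1..}"
    and unif: "\<And>n i. n \<ge> 1 \<Longrightarrow> i \<ge> 1 \<Longrightarrow>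
      distr (M n) (count_space UNIV) (X n i) = measure_pmf (pmf_of_set {1..n})"
  shows "(\<forall>n\<ge>2. weak_conv_m
            (\<lambda>m. distr (M n) borel (standardized (M n) (coprime_pairs (X n) m)))
            std_normal_distribution) \<and>
         (\<forall>N::nat \<Rightarrow> nat. (\<forall>m\<ge>2. N m \<ge> 2) \<longrightarrow> weak_conv_m
            (\<lambda>m. distr (M (N m)) borel (standardized (M (N m)) (coprime_pairs (X (N m)) m)))
            std_normal_distribution)"
proof (intro conjI allI impI)
  fix n :: nat assume "2 \<le> n"
  then show "weak_conv_m (\<lambda>m. distr (M n) borel (standardized (M n) (coprime_pairs (X n) m)))
      std_normal_distribution"
    using coprime_pairs_clt[of M X "\<lambda>_. n", OF prob indep unif] by simp
next
  fix N :: "nat \<Rightarrow> nat" assume N: "\<forall>m\<ge>2. 2 \<le> N m"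
  let ?\<mu> = "\<lambda>N m. distr (M (N m)) borel (standardized (M (N m)) (coprime_pairs (X (N m)) m))"
  \<comment> \<open>\<open>N 0\<close> and \<open>N 1\<close> are unconstrained, and \<open>M 0\<close> need not be a probability space; changing these
    two terms does not affect the limit.\<close>
  define N' where "N' m = max 2 (N m)" for m
  have "weak_conv_m (?\<mu> N') std_normal_distribution"
    by (rule coprime_pairs_clt[OF prob indep unif]) (simp_all add: N'_def)
  moreover have "\<forall>\<^sub>F m in sequentially. cdf (?\<mu> N' m) x = cdf (?\<mu> N m) x" for x
    using eventually_ge_at_top[of 2] by eventually_elim (use N in \<open>simp add: N'_def max_absorb2\<close>)
  ultimately show "weak_conv_m (?\<mu> N) std_normal_distribution"
    unfolding weak_conv_m_def weak_conv_def by (auto intro: Lim_transform_eventually)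
qed

end
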